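(* Let $K$ be a field of characteristic zero, let $n=2r+1$ with $r\ge0$ an integer, and let $X_3$ be the $n\times n$ tridiagonal skew-symmetric matrix whose $(i,i+1)$ entry is an indeterminate $x_{i\,i+1}$ and whose $(i+1,i)$ entry is $-x_{i\,i+1}$ for $1\le i\le n-1$, all other entries being $0$. Then $I=\mathrm{Pf}_{n-1}(X_3)\subseteq K[X_3]$ is a monomial ideal of Gröbner linear type.
   Context: $K[X_3]=K[x_{12},x_{23},\dots,x_{n-1\,n}]$ is the polynomial ring in the distinct indeterminates $x_{i\,i+1}$. For a skew-symmetric matrix $M$ of even order, $\mathrm{Pf}(M)$ is the Pfaffian, with $\mathrm{Pf}(M)^2=\det M$ (the Pfaffian of the empty matrix is $1$). $\mathrm{Pf}_{n-1}(X_3)$ is the ideal generated by the Pfaffians of the $n$ submatrices obtained from $X_3$ by deleting the $\ell$-th row and $\ell$-th column, $\ell=1,\dots,n$. For an ideal $I$ of $A=K[x\text{'s}]$ with (minimal, homogeneous) generators $u_1,\dots,u_s$, write $\mathcal R(I)=\bigoplus_{i\ge0}I^i\cong A[y_1,\dots,y_s]/J$ with $y_j\mapsto u_j$ in the first power $I^1$. The ideal $I$ is of linear type if $J$ is generated by elements that are linear (homogeneous of degree $1$) in $y_1,\dots,y_s$; it is of Gröbner linear type if it is of linear type and the relations in $J$ that are linear in the $y$'s form a Gröbner basis of $J$ with respect to some monomial order on $A[y_1,\dots,y_s]$. *)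

theory Defs
  imports
    "HOL-Library.Poly_Mapping"
    "HOL-Algebra.Ideal_Product"
    "Jordan_Normal_Form.Determinant"
begin

section \<open>Polynomial rings over a field\<close>

text \<open>
  A monomial in indeterminates indexed by \<^typ>\<open>'v\<close> is its exponent vector; the polynomial ring in
  the indeterminates indexed by a set \<open>V\<close> is cut out of the type of all polynomials.
\<close>

type_synonym 'v monomial = "'v \<Rightarrow>\<^sub>0 nat"
type_synonym ('v, 'k) mpoly = "'v monomial \<Rightarrow>\<^sub>0 'k"

definition monomials :: "'v set \<Rightarrow> 'v monomial set" where
  "monomials V = {m. Poly_Mapping.keys m \<subseteq> V}"

definition mpoly_monomial :: "'v monomial \<Rightarrow> ('v, 'k::field) mpoly" where
  "mpoly_monomial m = Poly_Mapping.single m 1"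

definition Var :: "'v \<Rightarrow> ('v, 'k::field) mpoly" where
  "Var v = mpoly_monomial (Poly_Mapping.single v 1)"

definition Const :: "'k \<Rightarrow> ('v, 'k::field) mpoly" where
  "Const c = Poly_Mapping.single 0 c"

definition poly_ring :: "'v set \<Rightarrow> ('v, 'k::field) mpoly ring" where
  "poly_ring V = \<lparr>carrier = {p. Poly_Mapping.keys p \<subseteq> monomials V},
     monoid.mult = (*), one = 1, zero = 0, add = (+)\<rparr>"

lemma poly_ring_simps:
  "carrier (poly_ring V) = {p. Poly_Mapping.keys p \<subseteq> monomials V}"
  "x \<otimes>\<^bsub>poly_ring V\<^esub> y = x * y" "\<one>\<^bsub>poly_ring V\<^esub> = 1"
  "x \<oplus>\<^bsub>poly_ring V\<^esub> y = x + y" "\<zero>\<^bsub>poly_ring V\<^esub> = 0"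
  by (simp_all add: poly_ring_def)

lemma monomials_add: "a \<in> monomials V \<Longrightarrow> b \<in> monomials V \<Longrightarrow> a + b \<in> monomials V"
  using Poly_Mapping.keys_add[of a b] by (auto simp: monomials_def)

lemma poly_ring_cring: "cring (poly_ring V)"
proof (rule cringI)
  show "abelian_group (poly_ring V :: ('a, 'b) mpoly ring)"
  proof (rule abelian_groupI)
    fix x :: "('a, 'b) mpoly" assume "x \<in> carrier (poly_ring V)"
    then have "- x \<in> carrier (poly_ring V)" by (simp add: poly_ring_simps Poly_Mapping.keys_minus)
    then show "\<exists>y\<in>carrier (poly_ring V). y \<oplus>\<^bsub>poly_ring V\<^esub> x = \<zero>\<^bsub>poly_ring V\<^esub>"
      by (intro bexI[of _ "- x"]) (simp_all add: poly_ring_simps)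
  next
    fix x y :: "('a, 'b) mpoly"
    assume "x \<in> carrier (poly_ring V)" "y \<in> carrier (poly_ring V)"
    then show "x \<oplus>\<^bsub>poly_ring V\<^esub> y \<in> carrier (poly_ring V)"
      using Poly_Mapping.keys_add[of x y] by (auto simp: poly_ring_simps)
  qed (auto simp: poly_ring_simps ac_simps)
  show "Group.comm_monoid (poly_ring V :: ('a, 'b) mpoly ring)"
  proof (rule comm_monoidI)
    fix x y :: "('a, 'b) mpoly"
    assume "x \<in> carrier (poly_ring V)" "y \<in> carrier (poly_ring V)"
    then show "x \<otimes>\<^bsub>poly_ring V\<^esub> y \<in> carrier (poly_ring V)"
      using Poly_Mapping.keys_mult[of x y] monomials_add
      by (fastforce simp: poly_ring_simps)
  qed (auto simp: poly_ring_simps ac_simps monomials_def)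
qed (auto simp: poly_ring_simps algebra_simps)

definition mono_degree :: "'v monomial \<Rightarrow> nat" where
  "mono_degree m = (\<Sum>v\<in>Poly_Mapping.keys m. Poly_Mapping.lookup m v)"

definition homogeneous :: "('v, 'k::field) mpoly \<Rightarrow> bool" where
  "homogeneous p \<longleftrightarrow> (\<exists>d. \<forall>m\<in>Poly_Mapping.keys p. mono_degree m = d)"

text \<open>The ring homomorphism that is \<open>c\<close> on coefficients and sends the indeterminate \<open>v\<close> to \<open>s v\<close>.\<close>

definition eval_mpoly ::
    "('k \<Rightarrow> 'r) \<Rightarrow> ('v \<Rightarrow> 'r) \<Rightarrow> ('v, 'k::field) mpoly \<Rightarrow> 'r::comm_ring_1" where
  "eval_mpoly c s p = (\<Sum>m\<in>Poly_Mapping.keys p.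
     c (Poly_Mapping.lookup p m) * (\<Prod>v\<in>Poly_Mapping.keys m. s v ^ Poly_Mapping.lookup m v))"

definition monomial_ideal :: "'v set \<Rightarrow> ('v, 'k::field) mpoly set \<Rightarrow> bool" where
  "monomial_ideal V I \<longleftrightarrow> (\<exists>M \<subseteq> monomials V. I = genideal (poly_ring V) (mpoly_monomial ` M))"


section \<open>Groebner bases\<close>

definition monomial_order :: "'v set \<Rightarrow> 'v monomial rel \<Rightarrow> bool" where
  "monomial_order V ord \<longleftrightarrow>
     linear_order_on (monomials V) ord \<and>
     (\<forall>m\<in>monomials V. (0, m) \<in> ord) \<and>
     (\<forall>a b. \<forall>c\<in>monomials V. (a, b) \<in> ord \<longrightarrow> (a + c, b + c) \<in> ord)"

definition lead_monomial :: "'v monomial rel \<Rightarrow> ('v, 'k::field) mpoly \<Rightarrow> 'v monomial" where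
  "lead_monomial ord p =
     (THE m. m \<in> Poly_Mapping.keys p \<and> (\<forall>m'\<in>Poly_Mapping.keys p. (m', m) \<in> ord))"

definition initial_ideal ::
    "'v set \<Rightarrow> 'v monomial rel \<Rightarrow> ('v, 'k::field) mpoly set \<Rightarrow> ('v, 'k) mpoly set" where
  "initial_ideal V ord F =
     genideal (poly_ring V) {mpoly_monomial (lead_monomial ord f) | f. f \<in> F \<and> f \<noteq> 0}"

definition groebner_basis ::
    "'v set \<Rightarrow> 'v monomial rel \<Rightarrow> ('v, 'k::field) mpoly set \<Rightarrow> ('v, 'k) mpoly set \<Rightarrow> bool" where
  "groebner_basis V ord G J \<longleftrightarrow>
     finite G \<and> G \<subseteq> J \<and> initial_ideal V ord G = initial_ideal V ord J"


section \<open>Rees algebras and ideals of (Groebner) linear type\<close>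

primrec ideal_power :: "('a, 'b) ring_scheme \<Rightarrow> 'a set \<Rightarrow> nat \<Rightarrow> 'a set" where
  "ideal_power R I 0 = carrier R"
| "ideal_power R I (Suc i) = ideal_prod R I (ideal_power R I i)"

text \<open>
  The direct sum of the powers of \<open>I\<close>: its elements, finitely supported sequences with \<open>i\<close>-th term
  in \<open>I\<^sup>i\<close>, are the coefficient sequences of univariate polynomials, and its multiplication is
  convolution.
\<close>

definition rees_algebra ::
    "'v set \<Rightarrow> ('v, 'k::field) mpoly set \<Rightarrow> ('v, 'k) mpoly poly ring" where
  "rees_algebra V I =
     \<lparr>carrier = {p. \<forall>i. coeff p i \<in> ideal_power (poly_ring V) I i},
      monoid.mult = (*), one = 1, zero = 0, add = (+)\<rparr>"

text \<open>
  For \<open>A = poly_ring V\<close> and a list \<open>us\<close> of \<open>s\<close> elements of \<open>A\<close>, the ring \<open>A[y\<^sub>1, \<dots>, y\<^sub>s]\<close> is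
  \<open>poly_ring (V <+> {..<s})\<close>: \<open>Inl v\<close> indexes the indeterminate \<open>v\<close> of \<open>A\<close> and \<open>Inr j\<close> indexes the
  \<open>y\<close> that belongs to \<open>us ! j\<close>.
\<close>

definition rees_vars :: "'v set \<Rightarrow> ('v, 'k::field) mpoly list \<Rightarrow> ('v + nat) set" where
  "rees_vars V us = V <+> {..<length us}"

definition rees_map ::
    "('v, 'k::field) mpoly list \<Rightarrow> ('v + nat, 'k) mpoly \<Rightarrow> ('v, 'k) mpoly poly" where
  "rees_map us = eval_mpoly (\<lambda>c. [:Const c:])
     (\<lambda>w. case w of Inl v \<Rightarrow> [:Var v:] | Inr j \<Rightarrow> monom (us ! j) 1)"

definition rees_ideal ::
    "'v set \<Rightarrow> ('v, 'k::field) mpoly set \<Rightarrow> ('v, 'k) mpoly list \<Rightarrow> ('v + nat, 'k) mpoly set" where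
  "rees_ideal V I us =
     a_kernel (poly_ring (rees_vars V us)) (rees_algebra V I) (rees_map us)"

definition linear_in_y :: "('v + nat, 'k::field) mpoly \<Rightarrow> bool" where
  "linear_in_y f \<longleftrightarrow> (\<forall>m\<in>Poly_Mapping.keys f.
     (\<Sum>w\<in>Poly_Mapping.keys m \<inter> range Inr. Poly_Mapping.lookup m w) = 1)"

definition linear_relations ::
    "'v set \<Rightarrow> ('v, 'k::field) mpoly set \<Rightarrow> ('v, 'k) mpoly list \<Rightarrow> ('v + nat, 'k) mpoly set" where
  "linear_relations V I us = {f \<in> rees_ideal V I us. linear_in_y f}"

definition minimal_homogeneous_generators ::
    "'v set \<Rightarrow> ('v, 'k::field) mpoly set \<Rightarrow> ('v, 'k) mpoly list \<Rightarrow> bool" where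
  "minimal_homogeneous_generators V I us \<longleftrightarrow>
     set us \<subseteq> carrier (poly_ring V) \<and> (\<forall>u\<in>set us. homogeneous u) \<and>
     genideal (poly_ring V) (set us) = I \<and>
     (\<forall>j<length us. genideal (poly_ring V) (set (take j us @ drop (Suc j) us)) \<noteq> I)"

text \<open>
  Both notions are about the presentation of the Rees algebra of \<open>I\<close> belonging to given minimal
  homogeneous generators \<open>us\<close> of \<open>I\<close>.
\<close>

definition linear_type ::
    "'v set \<Rightarrow> ('v, 'k::field) mpoly set \<Rightarrow> ('v, 'k) mpoly list \<Rightarrow> bool" where
  "linear_type V I us \<longleftrightarrow> minimal_homogeneous_generators V I us \<and>
     rees_ideal V I us = genideal (poly_ring (rees_vars V us)) (linear_relations V I us)"

text \<open>
  The linear relations are an infinite set in general, and Groebner bases are finite here: they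
  form a Groebner basis when finitely many of them do.
\<close>

definition groebner_linear_type ::
    "'v set \<Rightarrow> ('v, 'k::field) mpoly set \<Rightarrow> ('v, 'k) mpoly list \<Rightarrow> bool" where
  "groebner_linear_type V I us \<longleftrightarrow> linear_type V I us \<and>
     (\<exists>ord. monomial_order (rees_vars V us) ord \<and>
        (\<exists>G \<subseteq> linear_relations V I us.
           groebner_basis (rees_vars V us) ord G (rees_ideal V I us)))"


section \<open>Pfaffians of the tridiagonal skew-symmetric matrix\<close>

text \<open>
  The sum over perfect matchings
  \<open>{\<sigma> 0 < \<sigma> 1}, {\<sigma> 2 < \<sigma> 3}, \<dots>\<close> with \<open>\<sigma> 0 < \<sigma> 2 < \<dots>\<close> of the indices; only meaningful for
  skew-symmetric matrices of even order.
\<close>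

definition pfaffian :: "'a::comm_ring_1 mat \<Rightarrow> 'a" where
  "pfaffian A = (let m = dim_row A div 2 in
     \<Sum>\<sigma> | \<sigma> permutes {..<2 * m} \<and> (\<forall>i<m. \<sigma> (2 * i) < \<sigma> (2 * i + 1)) \<and>
            (\<forall>i j. i < j \<longrightarrow> j < m \<longrightarrow> \<sigma> (2 * i) < \<sigma> (2 * j)).
       of_int (sign \<sigma>) * (\<Prod>i<m. A $$ (\<sigma> (2 * i), \<sigma> (2 * i + 1))))"

text \<open>Rows and columns are numbered from 0, so \<open>Var i\<close> is \<open>x\<^sub>k\<^sub>l\<close> with \<open>k = i + 1\<close>, \<open>l = i + 2\<close>.\<close>

definition X3 :: "nat \<Rightarrow> (nat, 'k::field) mpoly mat" where
  "X3 n = mat n n (\<lambda>(i, j). if j = i + 1 then Var i else if i = j + 1 then - Var j else 0)"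

definition X3_vars :: "nat \<Rightarrow> nat set" where
  "X3_vars n = {..<n - 1}"

text \<open>
  Every second one of these \<open>n\<close> Pfaffians is zero if \<open>n\<close> is odd, so that only the nonzero ones can
  be minimal generators of the ideal \<open>Pf_ideal n\<close>.
\<close>

definition X3_pfaffians :: "nat \<Rightarrow> (nat, 'k::field) mpoly list" where
  "X3_pfaffians n = map (\<lambda>l. pfaffian (mat_delete (X3 n) l l)) [0..<n]"

definition Pf_ideal :: "nat \<Rightarrow> (nat, 'k::field) mpoly set" where
  "Pf_ideal n = genideal (poly_ring (X3_vars n)) (set (X3_pfaffians n))"

end

theory Submission
  imports Defs "HOL-Library.Nat_Bijection"
begin

text \<open>
  \<^bold>\<open>Generators.\<close> The matrix is the weighted skew adjacency matrix of the path with vertices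
  \<open>0, \<dots>, 2r\<close>, and \<open>x\<^sub>i\<close> belongs to the edge \<open>i\<close> between \<open>i\<close> and \<open>i + 1\<close>. The terms of a Pfaffian are
  perfect matchings. The path without the vertex \<open>l\<close> has at most one perfect matching, and it has one
  if and only if \<open>l = 2k\<close> is even. Then the edges of the matching are \<open>2i\<close> for \<open>i < k\<close> and \<open>2i + 1\<close>
  for \<open>k \<le> i < r\<close>, all signs are positive, and the Pfaffian is the squarefree monomial
  \<open>u\<^sub>k = \<Prod>\<^bsub>i<k\<^esub> x\<^bsub>2i\<^esub> \<cdot> \<Prod>\<^bsub>k\<le>i<r\<^esub> x\<^bsub>2i+1\<^esub>\<close> (\<open>pfaffian_X3_delete\<close>). The monomials
  \<open>u\<^sub>0, \<dots>, u\<^sub>r\<close> are distinct and of the same degree, hence minimal generators.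

  \<^bold>\<open>Relations.\<close> Consecutive generators differ by the exchange of one edge,
  \<open>x\<^bsub>2k\<^esub> u\<^sub>k = x\<^bsub>2k+1\<^esub> u\<^bsub>k+1\<^esub>\<close>, so that \<open>x\<^bsub>2k\<^esub> y\<^sub>k - x\<^bsub>2k+1\<^esub> y\<^bsub>k+1\<^esub>\<close> is a relation in \<open>J\<close> that is
  linear in the \<open>y\<close>'s. In a suitable lexicographic order its leading monomial is \<open>x\<^bsub>2k\<^esub> y\<^sub>k\<close>. Call a
  monomial of \<open>A[y]\<close> standard if none of these \<open>r\<close> leading monomials divides it. Replacing
  \<open>x\<^bsub>2k\<^esub> y\<^sub>k\<close> by \<open>x\<^bsub>2k+1\<^esub> y\<^bsub>k+1\<^esub>\<close> moves the indices of the \<open>y\<close>'s up, so it terminates, and every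
  monomial is congruent to a standard one (\<open>reduce_to_standard\<close>).

  \<^bold>\<open>Independence.\<close> The presentation map sends monomials to monomials, and it is injective on the
  standard ones (\<open>standard_inj\<close>): the exponent of \<open>x\<^bsub>2i\<^esub>\<close> in the image is its exponent in the
  monomial plus the number of \<open>y\<^sub>j\<close> with \<open>j > i\<close>; as a standard monomial cannot contain both
  \<open>x\<^bsub>2i\<^esub>\<close> and \<open>y\<^sub>i\<close>, this and the degree determine the exponents of \<open>y\<^sub>0, y\<^sub>1, \<dots>\<close> one after the
  other. Hence no nonzero element of \<open>J\<close> is a combination of standard
  monomials, and the general criterion \<open>groebner_basis_by_standard_monomials\<close> yields at the same time
  that the \<open>r\<close> linear relations generate \<open>J\<close> and that they form a Groebner basis of it.
\<close>

section \<open>Evaluation of polynomials\<close>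

lemma poly_mapping_sum_single:
  fixes p :: "'a \<Rightarrow>\<^sub>0 'b::comm_monoid_add"
  shows "(\<Sum>m\<in>Poly_Mapping.keys p. Poly_Mapping.single m (Poly_Mapping.lookup p m)) = p"
  by (rule poly_mapping_eqI)
    (simp add: lookup_sum lookup_single when_def sum.delta in_keys_iff)

definition monomial_value :: "('v \<Rightarrow> 'r::comm_ring_1) \<Rightarrow> 'v monomial \<Rightarrow> 'r" where
  "monomial_value s m = (\<Prod>v\<in>Poly_Mapping.keys m. s v ^ Poly_Mapping.lookup m v)"

lemma monomial_value_superset:
  assumes "finite A" "Poly_Mapping.keys m \<subseteq> A"
  shows "monomial_value s m = (\<Prod>v\<in>A. s v ^ Poly_Mapping.lookup m v)"
  unfolding monomial_value_def using assms
  by (intro prod.mono_neutral_left) (auto simp: in_keys_iff)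

lemma monomial_value_add: "monomial_value s (a + b) = monomial_value s a * monomial_value s b"
proof -
  let ?A = "Poly_Mapping.keys a \<union> Poly_Mapping.keys b"
  have "Poly_Mapping.keys (a + b) \<subseteq> ?A" by (rule Poly_Mapping.keys_add)
  then show ?thesis
    by (simp add: monomial_value_superset[of ?A] lookup_add power_add prod.distrib)
qed

lemma monomial_value_sum: "monomial_value s (sum e A) = (\<Prod>i\<in>A. monomial_value s (e i))"
  by (induction A rule: infinite_finite_induct)
    (simp_all add: monomial_value_add, simp_all add: monomial_value_def)

lemma monomial_value_single [simp]: "monomial_value s (Poly_Mapping.single v (Suc 0)) = s v"
  by (simp add: monomial_value_def)

text \<open>
  The maps on coefficients for which \<open>eval_mpoly\<close> is a ring homomorphism. Two of them occur: the
  inclusion of the field into the target of the presentation of the Rees algebra, and the identity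
  of the field, for evaluation at a point.
\<close>

locale coefficient_hom =
  fixes c :: "'k::field \<Rightarrow> 'r::comm_ring_1"
  assumes hom_zero: "c 0 = 0" and hom_one: "c 1 = 1"
    and hom_add: "c (a + b) = c a + c b" and hom_mult: "c (a * b) = c a * c b"
begin

lemma eval_superset:
  assumes "finite A" "Poly_Mapping.keys p \<subseteq> A"
  shows "eval_mpoly c s p = (\<Sum>m\<in>A. c (Poly_Mapping.lookup p m) * monomial_value s m)"
  unfolding eval_mpoly_def monomial_value_def[symmetric] using assms
  by (intro sum.mono_neutral_left) (auto simp: in_keys_iff hom_zero)

lemma eval_zero: "eval_mpoly c s 0 = 0"
  by (simp add: eval_mpoly_def)

lemma eval_single: "eval_mpoly c s (Poly_Mapping.single m a) = c a * monomial_value s m"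
  by (subst eval_superset[of "{m}"]) auto

lemma eval_monomial: "eval_mpoly c s (mpoly_monomial m) = monomial_value s m"
  by (simp add: mpoly_monomial_def eval_single hom_one)

lemma eval_add: "eval_mpoly c s (p + q) = eval_mpoly c s p + eval_mpoly c s q"
proof -
  let ?A = "Poly_Mapping.keys p \<union> Poly_Mapping.keys q"
  have "Poly_Mapping.keys (p + q) \<subseteq> ?A" by (rule Poly_Mapping.keys_add)
  then show ?thesis
    by (simp add: eval_superset[of ?A] lookup_add hom_add sum.distrib algebra_simps)
qed

lemma eval_sum: "eval_mpoly c s (sum f B) = (\<Sum>b\<in>B. eval_mpoly c s (f b))"
  by (induction B rule: infinite_finite_induct) (simp_all add: eval_zero eval_add)

lemma eval_diff: "eval_mpoly c s (p - q) = eval_mpoly c s p - eval_mpoly c s q"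
  using eval_add[of s "p - q" q] by simp

lemma eval_mult: "eval_mpoly c s (p * q) = eval_mpoly c s p * eval_mpoly c s q"
proof -
  let ?S = "\<lambda>p m. Poly_Mapping.single m (Poly_Mapping.lookup p m)"
  have expand: "eval_mpoly c s p = (\<Sum>m\<in>Poly_Mapping.keys p. eval_mpoly c s (?S p m))" for p
    by (simp flip: eval_sum add: poly_mapping_sum_single)
  have "eval_mpoly c s (p * q) = eval_mpoly c s
      ((\<Sum>m\<in>Poly_Mapping.keys p. ?S p m) * (\<Sum>m\<in>Poly_Mapping.keys q. ?S q m))"
    by (simp add: poly_mapping_sum_single)
  also have "\<dots> = (\<Sum>m\<in>Poly_Mapping.keys p. \<Sum>n\<in>Poly_Mapping.keys q.
      eval_mpoly c s (?S p m) * eval_mpoly c s (?S q n))"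
    by (simp add: sum_product eval_sum mult_single eval_single hom_mult monomial_value_add
        algebra_simps)
  finally show ?thesis by (simp add: expand[of p] expand[of q] sum_product)
qed

text \<open>
  The ideal of relations has this form, and so has the vanishing ideal of a point, which separates
  one generator from the others in the proof of minimality.
\<close>

lemma eval_kernel_ideal:
  fixes V :: "'v set"
  shows "ideal {p \<in> carrier (poly_ring V). eval_mpoly c s p = 0} (poly_ring V)"
proof -
  interpret R: cring "poly_ring V :: ('v, 'k) mpoly ring" by (rule poly_ring_cring)
  let ?K = "{p \<in> carrier (poly_ring V). eval_mpoly c s p = 0}"
  show ?thesis
  proof (rule idealI)
    show "ring (poly_ring V :: ('v, 'k) mpoly ring)" by (rule R.ring_axioms)
    show "subgroup ?K (add_monoid (poly_ring V))"
    proof (rule group.subgroupI)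
      show "group (add_monoid (poly_ring V :: ('v, 'k) mpoly ring))" by (rule R.a_group)
      show "?K \<noteq> {}" using R.zero_closed by (auto simp: poly_ring_simps(5) eval_zero)
    next
      fix p :: "('v, 'k) mpoly" assume p: "p \<in> ?K"
      have "\<ominus>\<^bsub>poly_ring V\<^esub> p + p = 0"
        using R.l_neg[of p] p by (simp add: poly_ring_simps(4,5))
      then have "eval_mpoly c s (\<ominus>\<^bsub>poly_ring V\<^esub> p) = 0"
        using p eval_add[of s "\<ominus>\<^bsub>poly_ring V\<^esub> p" p] by (simp add: eval_zero)
      then have "\<ominus>\<^bsub>poly_ring V\<^esub> p \<in> ?K" using p R.a_inv_closed[of p] by simp
      then show "inv\<^bsub>add_monoid (poly_ring V)\<^esub> p \<in> ?K" by (simp add: a_inv_def)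
    next
      fix p q :: "('v, 'k) mpoly" assume "p \<in> ?K" "q \<in> ?K"
      then show "p \<otimes>\<^bsub>add_monoid (poly_ring V)\<^esub> q \<in> ?K"
        using R.a_closed[of p q] by (simp add: poly_ring_simps(4) eval_add)
    qed auto
  next
    fix a x :: "('v, 'k) mpoly"
    assume "a \<in> ?K" "x \<in> carrier (poly_ring V)"
    then show "x \<otimes>\<^bsub>poly_ring V\<^esub> a \<in> ?K" "a \<otimes>\<^bsub>poly_ring V\<^esub> x \<in> ?K"
      using R.m_closed[of x a] R.m_closed[of a x] by (simp_all add: poly_ring_simps(2) eval_mult)
  qed
qed

end

lemma coefficient_hom_id: "coefficient_hom (\<lambda>c::'k::field. c)"
  by unfold_locales auto

lemma coefficient_hom_Const:
  "coefficient_hom (\<lambda>c::'k::field. [:Const c :: ('v, 'k) mpoly:])"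
  by unfold_locales (simp_all add: Const_def single_add mult_single one_pCons mult.commute)


section \<open>Ideals of polynomial rings\<close>

lemma mpoly_monomial_add: "mpoly_monomial (a + b) = mpoly_monomial a * mpoly_monomial b"
  by (simp add: mpoly_monomial_def mult_single)

lemma mpoly_monomial_sum: "mpoly_monomial (sum e A) = (\<Prod>i\<in>A. mpoly_monomial (e i))"
proof (induction A rule: infinite_finite_induct)
qed (simp_all add: mpoly_monomial_add, simp_all add: mpoly_monomial_def)

lemma keys_mpoly_monomial [simp]:
  "Poly_Mapping.keys (mpoly_monomial m :: ('v, 'k::field) mpoly) = {m}"
  by (simp add: mpoly_monomial_def)

lemma mpoly_monomial_neq_0 [simp]: "(mpoly_monomial m :: ('v, 'k::field) mpoly) \<noteq> 0"
  by (metis keys_mpoly_monomial keys_zero insert_not_empty)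

lemma mpoly_monomial_carrier [simp]:
  "mpoly_monomial m \<in> carrier (poly_ring V) \<longleftrightarrow> m \<in> monomials V"
  by (simp add: poly_ring_simps)

lemma genideal_poly_ring:
  assumes "S \<subseteq> carrier (poly_ring V)"
  shows "ideal (genideal (poly_ring V) S) (poly_ring V)" and "S \<subseteq> genideal (poly_ring V) S"
  using ring.genideal_ideal[OF cring.axioms(1)[OF poly_ring_cring] assms]
    ring.genideal_self[OF cring.axioms(1)[OF poly_ring_cring] assms] .

lemma genideal_subset:
  assumes "ideal J (poly_ring V)" "S \<subseteq> J"
  shows "genideal (poly_ring V) S \<subseteq> J"
  using assms by (auto simp: genideal_def)

context
  fixes J :: "('v, 'k::field) mpoly set" and V
  assumes J: "ideal J (poly_ring V)"
begin

lemma ideal_subset_carrier: "J \<subseteq> carrier (poly_ring V)"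
  using J by (meson additive_subgroup.a_subset ideal.axioms(1))

lemma ideal_zero: "0 \<in> J"
  using additive_subgroup.zero_closed[OF ideal.axioms(1)[OF J]] by (simp add: poly_ring_simps)

lemma ideal_add: "p \<in> J \<Longrightarrow> q \<in> J \<Longrightarrow> p + q \<in> J"
  using additive_subgroup.a_closed[OF ideal.axioms(1)[OF J]] by (simp add: poly_ring_simps)

lemma ideal_mult: "p \<in> J \<Longrightarrow> q \<in> carrier (poly_ring V) \<Longrightarrow> q * p \<in> J"
  using ideal.I_l_closed[OF J] by (simp add: poly_ring_simps)

lemma ideal_sum: "(\<And>b. b \<in> B \<Longrightarrow> f b \<in> J) \<Longrightarrow> sum f B \<in> J"
  by (induction B rule: infinite_finite_induct) (simp_all add: ideal_zero ideal_add)

end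


section \<open>Lexicographic monomial orders\<close>

text \<open>
  The bijection \<open>e\<close> numbers the indeterminates; the one with the smallest number is the most
  significant, because the order on \<^typ>\<open>nat \<Rightarrow>\<^sub>0 nat\<close> compares at the smallest index where two
  exponent vectors differ.
\<close>

definition lex_order :: "('v \<Rightarrow> nat) \<Rightarrow> 'v set \<Rightarrow> 'v monomial rel" where
  "lex_order e V = {(a, b). a \<in> monomials V \<and> b \<in> monomials V \<and>
     Poly_Mapping.map_key (inv_into UNIV e) a \<le> Poly_Mapping.map_key (inv_into UNIV e) b}"

lemma lookup_map_key:
  "inj f \<Longrightarrow> Poly_Mapping.lookup (Poly_Mapping.map_key f p) i = Poly_Mapping.lookup p (f i)"
  by (simp add: map_key.rep_eq)

lemma less_poly_mapping_iff: "p < q \<longleftrightarrow> (\<exists>k. Poly_Mapping.lookup p k < Poly_Mapping.lookup q k \<and>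
    (\<forall>k'<k. Poly_Mapping.lookup p k' = Poly_Mapping.lookup q k'))"
  by (simp add: less_poly_mapping.rep_eq less_fun_def)

lemma monomial_order_lex:
  assumes "bij e"
  shows "monomial_order V (lex_order e V)"
proof -
  have inj: "inj (inv_into UNIV e)" using assms by (simp add: bij_imp_bij_inv bij_is_inj)
  have key: "Poly_Mapping.map_key (inv_into UNIV e) a = Poly_Mapping.map_key (inv_into UNIV e) b
      \<longleftrightarrow> a = b" for a b :: "'a monomial"
  proof
    assume eq: "Poly_Mapping.map_key (inv_into UNIV e) a = Poly_Mapping.map_key (inv_into UNIV e) b"
    show "a = b"
    proof (rule poly_mapping_eqI)
      fix v
      have "Poly_Mapping.lookup (Poly_Mapping.map_key (inv_into UNIV e) a) (e v) =
          Poly_Mapping.lookup (Poly_Mapping.map_key (inv_into UNIV e) b) (e v)"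
        by (simp only: eq)
      then show "Poly_Mapping.lookup a v = Poly_Mapping.lookup b v"
        using assms by (simp add: lookup_map_key[OF inj] bij_is_inj)
    qed
  qed simp
  have zero: "0 \<le> p" for p :: "nat monomial"
    unfolding not_less[symmetric] less_poly_mapping_iff by simp
  show ?thesis
    unfolding monomial_order_def
  proof (intro conjI ballI allI impI)
    show "linear_order_on (monomials V) (lex_order e V)"
      unfolding linear_order_on_def partial_order_on_def preorder_on_def
    proof (intro conjI)
      show "lex_order e V \<subseteq> monomials V \<times> monomials V" by (auto simp: lex_order_def)
      show "refl_on (monomials V) (lex_order e V)" by (simp add: refl_on_def lex_order_def)
      show "trans (lex_order e V)" by (rule transI) (auto simp: lex_order_def)
      show "antisym (lex_order e V)"
        by (rule antisymI) (use key in \<open>force simp: lex_order_def dest: order.antisym\<close>)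
      show "total_on (monomials V) (lex_order e V)"
        by (simp add: total_on_def lex_order_def linear)
    qed
  next
    fix m :: "'a monomial" assume "m \<in> monomials V"
    then show "(0, m) \<in> lex_order e V"
      by (simp add: lex_order_def monomials_def zero map_key_zero[OF inj])
  next
    fix a b c :: "'a monomial" assume "c \<in> monomials V" "(a, b) \<in> lex_order e V"
    then show "(a + c, b + c) \<in> lex_order e V"
      by (simp add: lex_order_def monomials_add map_key_plus[OF inj] add_right_mono)
  qed
qed

lemma monomial_order_linear:
  assumes "monomial_order V ord"
  shows "refl_on (monomials V) ord" "trans ord" "antisym ord" "total_on (monomials V) ord"
proof -
  have "linear_order_on (monomials V) ord" using assms by (simp add: monomial_order_def)
  then show "refl_on (monomials V) ord" "trans ord" "antisym ord" "total_on (monomials V) ord"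
    by (simp_all add: linear_order_on_def partial_order_on_def preorder_on_def)
qed

lemma monomial_order_antisym: "monomial_order V ord \<Longrightarrow> (a, b) \<in> ord \<Longrightarrow> (b, a) \<in> ord \<Longrightarrow> a = b"
  by (rule antisymD[OF monomial_order_linear(3)])

lemma monomial_order_trans: "monomial_order V ord \<Longrightarrow> (a, b) \<in> ord \<Longrightarrow> (b, c) \<in> ord \<Longrightarrow> (a, c) \<in> ord"
  by (rule transD[OF monomial_order_linear(2)])

lemma monomial_order_refl: "monomial_order V ord \<Longrightarrow> a \<in> monomials V \<Longrightarrow> (a, a) \<in> ord"
  by (rule refl_onD[OF monomial_order_linear(1)])

lemma monomial_order_total:
  assumes "monomial_order V ord" "a \<in> monomials V" "b \<in> monomials V"
  shows "(a, b) \<in> ord \<or> (b, a) \<in> ord"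
  using monomial_order_linear(4)[OF assms(1)] monomial_order_refl[OF assms(1)] assms(2,3)
  by (cases "a = b") (simp_all add: total_on_def)

lemma monomial_order_add:
  "monomial_order V ord \<Longrightarrow> (a, b) \<in> ord \<Longrightarrow> c \<in> monomials V \<Longrightarrow> (a + c, b + c) \<in> ord"
  unfolding monomial_order_def by blast

lemma lead_monomial_eqI:
  assumes "monomial_order V ord" "m \<in> Poly_Mapping.keys p"
    and "\<And>m'. m' \<in> Poly_Mapping.keys p \<Longrightarrow> (m', m) \<in> ord"
  shows "lead_monomial ord p = m"
  unfolding lead_monomial_def using assms monomial_order_antisym[OF assms(1)]
  by (intro the_equality) auto

lemma lead_monomial:
  assumes ord: "monomial_order V ord" and "p \<in> carrier (poly_ring V)" "p \<noteq> 0"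
  shows "lead_monomial ord p \<in> Poly_Mapping.keys p"
    and "m' \<in> Poly_Mapping.keys p \<Longrightarrow> (m', lead_monomial ord p) \<in> ord"
proof -
  have "\<exists>m\<in>A. \<forall>m'\<in>A. (m', m) \<in> ord" if "finite A" "A \<noteq> {}" "A \<subseteq> monomials V" for A
    using that
  proof (induction A rule: finite_ne_induct)
    case (singleton a)
    then show ?case using monomial_order_refl[OF ord] by auto
  next
    case (insert a A)
    then obtain m where m: "m \<in> A" "\<forall>m'\<in>A. (m', m) \<in> ord" by auto
    with insert.prems consider "(m, a) \<in> ord" | "(a, m) \<in> ord"
      using monomial_order_total[OF ord, of m a] by auto
    then show ?case
    proof cases
      case 1
      then show ?thesis
        using m(2) insert.prems monomial_order_trans[OF ord _ 1] monomial_order_refl[OF ord, of a]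
        by (intro bexI[of _ a]) auto
    qed (use m in auto)
  qed
  from this[of "Poly_Mapping.keys p"] assms obtain m where
    "m \<in> Poly_Mapping.keys p" "\<forall>m'\<in>Poly_Mapping.keys p. (m', m) \<in> ord"
    by (auto simp: poly_ring_simps)
  moreover from this have "lead_monomial ord p = m" by (intro lead_monomial_eqI[OF ord]) auto
  ultimately show "lead_monomial ord p \<in> Poly_Mapping.keys p"
    and "m' \<in> Poly_Mapping.keys p \<Longrightarrow> (m', lead_monomial ord p) \<in> ord"
    by auto
qed


section \<open>Groebner bases from standard monomials\<close>

text \<open>
  Suppose that every monomial is congruent modulo \<open>G\<close> to a smaller or equal standard one, that every
  nonstandard monomial is divisible by the leading monomial of an element of \<open>G\<close>, and that no nonzero
  element of \<open>J\<close> is a combination of standard monomials. Replacing each monomial of \<open>f \<in> J\<close> by its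
  standard form changes \<open>f\<close> by an element of the ideal of \<open>G\<close> and leaves a combination of standard
  monomials in \<open>J\<close>, that is \<open>0\<close>; so \<open>G\<close> generates \<open>J\<close>. If the leading monomial of \<open>f\<close> were
  standard, then it would survive this replacement, since the standard forms of the other monomials
  of \<open>f\<close> are smaller than it; so it is divisible by a leading monomial of \<open>G\<close>.
\<close>

lemma groebner_basis_by_standard_monomials:
  fixes J :: "('v, 'k::field) mpoly set"
  assumes ord: "monomial_order V ord" and J: "ideal J (poly_ring V)"
    and G: "finite G" "G \<subseteq> J"
    and reduce: "\<And>m. m \<in> monomials V \<Longrightarrow> \<exists>n\<in>monomials V. standard n \<and> (n, m) \<in> ord \<and>
        mpoly_monomial m - mpoly_monomial n \<in> genideal (poly_ring V) G"
    and nonstandard: "\<And>m. m \<in> monomials V \<Longrightarrow> \<not> standard m \<Longrightarrow>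
        \<exists>g\<in>G. g \<noteq> 0 \<and> (\<exists>c\<in>monomials V. m = c + lead_monomial ord g)"
    and independent: "\<And>f. f \<in> J \<Longrightarrow> (\<And>m. m \<in> Poly_Mapping.keys f \<Longrightarrow> standard m) \<Longrightarrow> f = 0"
  shows "J = genideal (poly_ring V) G" and "groebner_basis V ord G J"
proof -
  let ?I = "genideal (poly_ring V) G"
  note JV = ideal_subset_carrier[OF J]
  have I: "ideal ?I (poly_ring V)" using G JV by (intro genideal_poly_ring) auto
  have IJ: "?I \<subseteq> J" by (rule genideal_subset[OF J G(2)])
  obtain N where N: "\<And>m. m \<in> monomials V \<Longrightarrow> N m \<in> monomials V"
    "\<And>m. m \<in> monomials V \<Longrightarrow> standard (N m)" "\<And>m. m \<in> monomials V \<Longrightarrow> (N m, m) \<in> ord"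
    "\<And>m. m \<in> monomials V \<Longrightarrow> mpoly_monomial m - mpoly_monomial (N m) \<in> ?I"
    using reduce by metis
  \<comment> \<open>replaces each monomial by its standard form\<close>
  define nf :: "('v, 'k) mpoly \<Rightarrow> ('v, 'k) mpoly" where "nf f =
    (\<Sum>m\<in>Poly_Mapping.keys f. Poly_Mapping.single (N m) (Poly_Mapping.lookup f m))" for f
  have diff_nf: "f - nf f \<in> ?I" if "f \<in> carrier (poly_ring V)" for f
  proof -
    have "f - nf f = (\<Sum>m\<in>Poly_Mapping.keys f. Poly_Mapping.single m (Poly_Mapping.lookup f m)) - nf f"
      by (simp add: poly_mapping_sum_single)
    also have "\<dots> = (\<Sum>m\<in>Poly_Mapping.keys f. Const (Poly_Mapping.lookup f m) *
        (mpoly_monomial m - mpoly_monomial (N m)))"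
      by (simp add: nf_def sum_subtractf[symmetric] Const_def mpoly_monomial_def mult_single
          right_diff_distrib)
    also have "\<dots> \<in> ?I"
    proof (intro ideal_sum[OF I] ideal_mult[OF I])
      fix m assume "m \<in> Poly_Mapping.keys f"
      then have "m \<in> monomials V" using that by (auto simp: poly_ring_simps)
      then show "mpoly_monomial m - mpoly_monomial (N m) \<in> ?I" by (rule N)
    qed (simp add: Const_def poly_ring_simps monomials_def)
    finally show ?thesis .
  qed
  have nf_0: "nf f = 0" if "f \<in> J" for f
  proof (rule independent)
    have fV: "f \<in> carrier (poly_ring V)" using that JV by auto
    have "- Const 1 * (f - nf f) \<in> J"
      using diff_nf[OF fV] IJ by (intro ideal_mult[OF J])
        (auto simp: Const_def poly_ring_simps monomials_def)
    moreover have "- Const 1 * (f - nf f) = nf f - f" by (simp add: Const_def)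
    ultimately show "nf f \<in> J" using ideal_add[OF J that, of "nf f - f"] by simp
    fix m assume "m \<in> Poly_Mapping.keys (nf f)"
    then have "m \<in> N ` Poly_Mapping.keys f"
      unfolding nf_def
      using Poly_Mapping.keys_sum[of "\<lambda>m. Poly_Mapping.single (N m) (Poly_Mapping.lookup f m)"
          "Poly_Mapping.keys f"]
      by (auto split: if_splits)
    then show "standard m" using N(2) fV by (auto simp: poly_ring_simps)
  qed
  show "J = ?I"
    using diff_nf nf_0 JV IJ by fastforce
  have lead: "\<exists>g\<in>G. g \<noteq> 0 \<and> (\<exists>c\<in>monomials V. lead_monomial ord f = c + lead_monomial ord g)"
    if f: "f \<in> J" "f \<noteq> 0" for f
  proof (rule nonstandard)
    let ?m = "lead_monomial ord f"
    have fV: "f \<in> carrier (poly_ring V)" using f JV by auto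
    note lm = lead_monomial[OF ord fV f(2)]
    show mV: "?m \<in> monomials V" using lm(1) fV by (auto simp: poly_ring_simps)
    \<comment> \<open>A difference of two congruent standard monomials lies in \<open>J\<close>, so it vanishes;
      in particular a standard monomial is its own standard form.\<close>
    have uniq: "n = n'"
      if "standard n" "standard n'" "mpoly_monomial n - mpoly_monomial n' \<in> ?I" for n n'
    proof (rule ccontr)
      assume "n \<noteq> n'"
      have "(mpoly_monomial n - mpoly_monomial n' :: ('v, 'k) mpoly) = 0"
      proof (rule independent)
        fix m assume "m \<in> Poly_Mapping.keys (mpoly_monomial n - mpoly_monomial n' :: ('v, 'k) mpoly)"
        then have "m \<in> {n, n'}"
          using Poly_Mapping.keys_diff[of "mpoly_monomial n" "mpoly_monomial n' :: ('v, 'k) mpoly"]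
          by auto
        then show "standard m" using that by auto
      qed (use that IJ in auto)
      then have "Poly_Mapping.keys (mpoly_monomial n :: ('v, 'k) mpoly) =
          Poly_Mapping.keys (mpoly_monomial n' :: ('v, 'k) mpoly)"
        by simp
      with \<open>n \<noteq> n'\<close> show False by simp
    qed
    show "\<not> standard ?m"
    proof
      assume std: "standard ?m"
      have "N m = ?m \<longleftrightarrow> m = ?m" if m: "m \<in> Poly_Mapping.keys f" for m
      proof
        assume "N m = ?m"
        then have "(?m, m) \<in> ord" using N(3)[of m] m fV by (auto simp: poly_ring_simps)
        then show "m = ?m" using lm(2)[OF m] monomial_order_antisym[OF ord] by auto
      next
        assume "m = ?m"
        then show "N m = ?m" using uniq[OF std N(2)[OF mV] N(4)[OF mV]] by simp
      qed
      then have "Poly_Mapping.lookup (nf f) ?m =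
          (\<Sum>m\<in>Poly_Mapping.keys f. if m = ?m then Poly_Mapping.lookup f ?m else 0)"
        unfolding nf_def lookup_sum by (intro sum.cong) (auto simp: lookup_single when_def)
      also have "\<dots> \<noteq> 0" using lm(1) by (simp add: in_keys_iff)
      finally show False using nf_0[OF f(1)] by simp
    qed
  qed
  have "initial_ideal V ord J \<subseteq> initial_ideal V ord G" 
    unfolding initial_ideal_def
  proof (rule genideal_subset)
    let ?S = "{mpoly_monomial (lead_monomial ord f) :: ('v, 'k) mpoly |f. f \<in> G \<and> f \<noteq> 0}"
    have "?S \<subseteq> carrier (poly_ring V)"
    proof clarify
      fix f assume f: "f \<in> G" "f \<noteq> 0"
      then have "f \<in> carrier (poly_ring V)" using G JV by auto
      with lead_monomial(1)[OF ord this f(2)] 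
      show "mpoly_monomial (lead_monomial ord f) \<in> carrier (poly_ring V)"
        unfolding mpoly_monomial_carrier by (auto simp: poly_ring_simps)
    qed
    note S = genideal_poly_ring[OF this]
    show "ideal (genideal (poly_ring V) ?S) (poly_ring V)" by (rule S)
    show "{mpoly_monomial (lead_monomial ord f) |f. f \<in> J \<and> f \<noteq> 0} \<subseteq> genideal (poly_ring V) ?S"
    proof clarify
      fix f assume "f \<in> J" "f \<noteq> 0"
      from lead[OF this] obtain g c where g: "g \<in> G" "g \<noteq> 0" "c \<in> monomials V"
        "lead_monomial ord f = c + lead_monomial ord g" by blast
      then have "mpoly_monomial (lead_monomial ord g) \<in> ?S" by auto
      then have "mpoly_monomial c * mpoly_monomial (lead_monomial ord g) \<in> genideal (poly_ring V) ?S"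
        using S(2) g(3) by (intro ideal_mult[OF S(1)]) auto
      then show "mpoly_monomial (lead_monomial ord f) \<in> genideal (poly_ring V) ?S"
        by (simp add: g(4) mpoly_monomial_add)
    qed
  qed
  moreover have "initial_ideal V ord G \<subseteq> initial_ideal V ord J"
    unfolding initial_ideal_def genideal_def using G(2)
    by (intro Inter_anti_mono Collect_mono conj_mono imp_refl order.trans[rotated]) auto
  ultimately show "groebner_basis V ord G J"
    using G unfolding groebner_basis_def by (intro conjI equalityI)
qed


section \<open>Pfaffians and the path\<close>

text \<open>
  A permutation contributes only if it matches each \<open>\<sigma> (2 * i)\<close> with its successor. As the values
  \<open>\<sigma> (2 * i)\<close> increase and never hit the successor of an earlier one, they go up in steps of at least
  \<open>2\<close>; so \<open>\<sigma> k \<ge> k\<close> for all \<open>k\<close>, and a permutation with this property is the identity.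
\<close>

lemma pfaffian_superdiagonal:
  fixes A :: "'a::comm_ring_1 mat"
  assumes dim: "dim_row A = 2 * m"
    and zero: "\<And>i j. i < j \<Longrightarrow> j < 2 * m \<Longrightarrow> j \<noteq> Suc i \<Longrightarrow> A $$ (i, j) = 0"
  shows "pfaffian A = (\<Prod>i<m. A $$ (2 * i, 2 * i + 1))"
proof -
  define S where "S = {\<sigma>. \<sigma> permutes {..<2 * m} \<and> (\<forall>i<m. \<sigma> (2 * i) < \<sigma> (2 * i + 1)) \<and>
    (\<forall>i j. i < j \<longrightarrow> j < m \<longrightarrow> \<sigma> (2 * i) < \<sigma> (2 * j))}"
  define t where "t \<sigma> = of_int (sign \<sigma>) * (\<Prod>i<m. A $$ (\<sigma> (2 * i), \<sigma> (2 * i + 1)))" for \<sigma>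
  have "t \<sigma> = 0" if S: "\<sigma> \<in> S" and "\<sigma> \<noteq> id" for \<sigma>
  proof (rule ccontr)
    assume "t \<sigma> \<noteq> 0"
    have ne: "A $$ (\<sigma> (2 * i), \<sigma> (2 * i + 1)) \<noteq> 0" if "i < m" for i
    proof
      assume "A $$ (\<sigma> (2 * i), \<sigma> (2 * i + 1)) = 0"
      with that have "(\<Prod>i<m. A $$ (\<sigma> (2 * i), \<sigma> (2 * i + 1))) = 0"
        by (intro prod_zero) auto
      with \<open>t \<sigma> \<noteq> 0\<close> show False by (simp add: t_def)
    qed
    have perm: "\<sigma> permutes {..<2 * m}" using S by (simp add: S_def)
    have incr: "\<sigma> (2 * i) < \<sigma> (2 * j)" if "i < j" "j < m" for i j
      using S that unfolding S_def by simp
    have adj: "\<sigma> (2 * i + 1) = Suc (\<sigma> (2 * i))" if "i < m" for i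
    proof (rule ccontr)
      assume "\<sigma> (2 * i + 1) \<noteq> Suc (\<sigma> (2 * i))"
      moreover have "\<sigma> (2 * i + 1) < 2 * m" using permutes_in_image[OF perm] that by simp
      ultimately show False using zero[of "\<sigma> (2 * i)" "\<sigma> (2 * i + 1)"] ne that S by (simp add: S_def)
    qed
    have even: "2 * i \<le> \<sigma> (2 * i)" if "i < m" for i
      using that
    proof (induction i)
      case (Suc i)
      have "\<sigma> (2 * i) < \<sigma> (2 * Suc i)" using incr[of i "Suc i"] Suc.prems by simp
      moreover have "\<sigma> (2 * Suc i) \<noteq> \<sigma> (2 * i + 1)"
        by (simp add: inj_eq[OF permutes_inj[OF perm]])
      ultimately show ?case using adj[of i] Suc by simp
    qed simp
    have "k \<le> \<sigma> k" if "k < 2 * m" for k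
    proof (cases "even k")
      case True
      then show ?thesis using even[of "k div 2"] that by auto
    next
      case False
      then have "k = 2 * (k div 2) + 1" by simp
      then show ?thesis using even[of "k div 2"] adj[of "k div 2"] that by simp
    qed
    then have "\<sigma> = id" using permutes_natset_ge[OF perm] by auto
    with \<open>\<sigma> \<noteq> id\<close> show False ..
  qed
  moreover have "finite S"
    by (rule finite_subset[OF _ finite_permutations[of "{..<2 * m}"]]) (auto simp: S_def)
  moreover have "id \<in> S" by (auto simp: S_def permutes_id)
  ultimately have "sum t S = t id"
    by (subst sum.mono_neutral_right[of S "{id}"]) auto
  moreover have "pfaffian A = sum t S"
    by (simp add: pfaffian_def dim S_def t_def)
  ultimately show ?thesis by (simp add: t_def)
qed

text \<open>
  The perfect matching of the path with vertices \<open>0, \<dots>, 2r\<close> from which the vertex \<open>2k\<close> is deleted: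
  the edges to the left of \<open>2k\<close> start at even vertices and those to the right of it at odd ones.
\<close>

definition matching_exponent :: "nat \<Rightarrow> nat \<Rightarrow> nat monomial" where
  "matching_exponent r k =
     (\<Sum>i<r. Poly_Mapping.single (if i < k then 2 * i else 2 * i + 1) 1)"

lemma lookup_matching_exponent_even:
  "Poly_Mapping.lookup (matching_exponent r k) (2 * i) = (if i < r \<and> i < k then 1 else 0)"
proof -
  have "Poly_Mapping.lookup (matching_exponent r k) (2 * i) =
      (\<Sum>j<r. if j = i then (if i < k then 1 else 0) else 0)"
    unfolding matching_exponent_def lookup_sum
    by (intro sum.cong) (auto simp: lookup_single when_def, presburger+)
  then show ?thesis by (simp add: sum.delta)
qed

text \<open>
  The matching that misses \<open>2k\<close> and the one that misses \<open>2k + 2\<close> differ only in the edge that covers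
  the vertex \<open>2k + 1\<close>; completing each with the edge of the other gives the linear relation between
  the two Pfaffians.
\<close>

lemma matching_exponent_exchange:
  assumes "k < r"
  shows "Poly_Mapping.single (2 * k) 1 + matching_exponent r k =
    Poly_Mapping.single (2 * k + 1) 1 + matching_exponent r (Suc k)"
proof -
  let ?e = "\<lambda>k i. Poly_Mapping.single (if i < k then 2 * i else 2 * i + 1) (1::nat)"
  have "matching_exponent r l = ?e l k + (\<Sum>i\<in>{..<r} - {k}. ?e l i)" for l
    unfolding matching_exponent_def using assms by (intro sum.remove) auto
  moreover have "(\<Sum>i\<in>{..<r} - {k}. ?e k i) = (\<Sum>i\<in>{..<r} - {k}. ?e (Suc k) i)"
    by (intro sum.cong) auto
  ultimately show ?thesis by (simp add: add.left_commute)
qed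

lemma matching_exponent_monomials: "matching_exponent r k \<in> monomials {..<2 * r}"
  unfolding matching_exponent_def monomials_def mem_Collect_eq
  by (rule order.trans[OF Poly_Mapping.keys_sum]) auto

definition matching_monomial :: "nat \<Rightarrow> nat \<Rightarrow> (nat, 'k::field) mpoly" where
  "matching_monomial r k = mpoly_monomial (matching_exponent r k)"

text \<open>
  After the deletion of \<open>l\<close> the entries right of the diagonal are those of a path that is interrupted
  between the positions \<open>l - 1\<close> and \<open>l\<close>. The matching of \<open>0\<close> with \<open>1\<close>, \<open>2\<close> with \<open>3\<close> and so on uses
  the missing edge exactly if \<open>l\<close> is odd.
\<close>

lemma pfaffian_X3_delete:
  assumes "l \<le> 2 * r"
  shows "pfaffian (mat_delete (X3 (2 * r + 1)) l l) =
    (if even l then matching_monomial r (l div 2) else (0 :: (nat, 'k::field) mpoly))"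
proof -
  define A where "A = mat_delete (X3 (2 * r + 1) :: (nat, 'k) mpoly mat) l l"
  \<comment> \<open>the position in the whole matrix of the \<open>i\<close>-th remaining row or column\<close>
  define skip where "skip i = (if i < l then i else Suc i)" for i
  have A: "A $$ (i, j) = X3 (2 * r + 1) $$ (skip i, skip j)" if "i < 2 * r" "j < 2 * r" for i j
    using that by (simp add: A_def mat_delete_def X3_def skip_def)
  have X: "X3 (2 * r + 1) $$ (skip i, skip j) = (if skip j = Suc (skip i) then Var (skip i) else
      if skip i = Suc (skip j) then - Var (skip j) else (0 :: (nat, 'k) mpoly))"
    if "i < 2 * r" "j < 2 * r" for i j
    using that by (simp add: X3_def skip_def)
  have "pfaffian A = (\<Prod>i<r. A $$ (2 * i, 2 * i + 1))"
  proof (rule pfaffian_superdiagonal)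
    show "dim_row A = 2 * r" by (simp add: A_def mat_delete_def X3_def)
    fix i j assume "i < j" "j < 2 * r" "j \<noteq> Suc i"
    moreover from this have ij: "i < 2 * r" "j < 2 * r" by auto
    ultimately show "A $$ (i, j) = 0" unfolding A[OF ij] X[OF ij] by (auto simp: skip_def)
  qed
  also have "\<dots> = (\<Prod>i<r. if 2 * i + 1 = l then 0 else
      mpoly_monomial (Poly_Mapping.single (if i < l div 2 then 2 * i else 2 * i + 1) 1))"
  proof (intro prod.cong refl)
    fix i assume "i \<in> {..<r}"
    then have i: "2 * i < 2 * r" "2 * i + 1 < 2 * r" by auto
    consider "2 * i + 1 = l" | "2 * i + 1 < l" | "l \<le> 2 * i" by linarith
    then show "A $$ (2 * i, 2 * i + 1) = (if 2 * i + 1 = l then 0 else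
        mpoly_monomial (Poly_Mapping.single (if i < l div 2 then 2 * i else 2 * i + 1) 1))"
    proof cases
      case 2
      then have "i < l div 2" by presburger
      with 2 show ?thesis unfolding A[OF i] X[OF i] by (simp add: skip_def Var_def)
    next
      case 3
      then have "\<not> i < l div 2" by presburger
      with 3 show ?thesis unfolding A[OF i] X[OF i] by (simp add: skip_def Var_def)
    qed (unfold A[OF i] X[OF i], simp add: skip_def)
  qed
  also have "\<dots> = (if even l then matching_monomial r (l div 2) else 0)"
  proof (cases "even l")
    case True
    then have "2 * i + 1 \<noteq> l" for i by auto
    with True show ?thesis
      by (simp add: matching_monomial_def matching_exponent_def mpoly_monomial_sum)
  next
    case False
    then have "2 * (l div 2) + 1 = l" by simp
    moreover from this assms have "l div 2 < r" by linarith
    ultimately show ?thesis using False by (auto intro!: prod_zero bexI[of _ "l div 2"])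
  qed
  finally show ?thesis by (simp add: A_def)
qed

section \<open>Monomial generators of the ideal of Pfaffians\<close>

lemma filter_even_positions:
  assumes "\<And>k. k \<le> r \<Longrightarrow> g k \<noteq> 0"
  shows "filter (\<lambda>p. p \<noteq> 0) (map (\<lambda>l. if even l then g (l div 2) else 0) [0..<2 * r + 1]) =
    map g [0..<Suc r]"
  using assms
proof (induction r)
  case (Suc r)
  have "[0..<2 * Suc r + 1] = [0..<2 * r + 1] @ [2 * r + 1, 2 * Suc r]" by simp
  then show ?case using Suc by simp
qed simp

definition matching_monomials :: "nat \<Rightarrow> (nat, 'k::field) mpoly list" where
  "matching_monomials r = map (matching_monomial r) [0..<Suc r]"

lemma set_matching_monomials: "set (matching_monomials r) = matching_monomial r ` {..r}"
  unfolding matching_monomials_def by (simp add: atLeast0LessThan lessThan_Suc_atMost del: upt_Suc)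

lemma X3_pfaffians_eq:
  "X3_pfaffians (2 * r + 1) =
    map (\<lambda>l. if even l then matching_monomial r (l div 2) else 0) [0..<2 * r + 1]"
  unfolding X3_pfaffians_def by (intro map_cong refl pfaffian_X3_delete) auto

lemma nonzero_X3_pfaffians: "filter (\<lambda>p. p \<noteq> 0) (X3_pfaffians (2 * r + 1)) = matching_monomials r"
  unfolding X3_pfaffians_eq matching_monomials_def
  by (rule filter_even_positions) (simp add: matching_monomial_def)

lemma matching_monomial_carrier: "matching_monomial r k \<in> carrier (poly_ring {..<2 * r})"
  by (simp add: matching_monomial_def matching_exponent_monomials)

lemma set_matching_monomials_carrier: "set (matching_monomials r) \<subseteq> carrier (poly_ring {..<2 * r})"
  by (auto simp: set_matching_monomials matching_monomial_carrier)

lemma Pf_ideal_eq: "(Pf_ideal (2 * r + 1) :: (nat, 'k::field) mpoly set) =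
    genideal (poly_ring {..<2 * r}) (set (matching_monomials r))"
proof -
  let ?R = "poly_ring {..<2 * r} :: (nat, 'k) mpoly ring"
  let ?S = "set (X3_pfaffians (2 * r + 1)) :: (nat, 'k) mpoly set"
  let ?T = "set (matching_monomials r) :: (nat, 'k) mpoly set"
  have T: "?T = ?S - {0}" by (auto simp flip: nonzero_X3_pfaffians)
  have zero: "0 \<in> carrier ?R" by (simp add: poly_ring_simps)
  have carr: "?S \<subseteq> carrier ?R"
    unfolding X3_pfaffians_eq using zero by (auto simp: matching_monomial_carrier)
  have "?T \<subseteq> carrier ?R" by (rule set_matching_monomials_carrier)
  note S = genideal_poly_ring[OF carr] and T' = genideal_poly_ring[OF this]
  have "?S \<subseteq> genideal ?R ?T" using T'(2) ideal_zero[OF T'(1)] unfolding T by blast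
  moreover have "?T \<subseteq> genideal ?R ?S" using S(2) unfolding T by blast
  ultimately have "genideal ?R ?S = genideal ?R ?T"
    using S(1) T'(1) by (intro equalityI genideal_subset)
  then show ?thesis by (simp add: Pf_ideal_def X3_vars_def)
qed

text \<open>
  To separate \<open>u\<^sub>j\<close> from the other generators, evaluate at the point where precisely the
  indeterminates of \<open>u\<^sub>j\<close> are \<open>1\<close> and all others \<open>0\<close>. Every other generator has an indeterminate that
  does not occur in \<open>u\<^sub>j\<close>: \<open>x\<^bsub>2k+1\<^esub>\<close> in \<open>u\<^sub>k\<close> if \<open>k < j\<close>, and \<open>x\<^bsub>2j\<^esub>\<close> in \<open>u\<^sub>k\<close> if \<open>k > j\<close>.
\<close>

lemma minimal_generators:
  "minimal_homogeneous_generators {..<2 * r} (Pf_ideal (2 * r + 1))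
    (matching_monomials r :: (nat, 'k::field) mpoly list)"
proof -
  let ?us = "matching_monomials r :: (nat, 'k) mpoly list"
  have "genideal (poly_ring {..<2 * r}) (set (take j ?us @ drop (Suc j) ?us)) \<noteq> Pf_ideal (2 * r + 1)"
    if "j \<le> r" for j
  proof
    define s :: "nat \<Rightarrow> 'k" where "s v = (if even v \<longleftrightarrow> v div 2 < j then 1 else 0)" for v
    define ev where "ev = eval_mpoly (\<lambda>c. c) s"
    interpret coefficient_hom "\<lambda>c::'k. c" by (rule coefficient_hom_id)
    have ev: "ev (matching_monomial r k) = (if k = j then 1 else 0)" if "k \<le> r" for k
    proof -
      have "ev (matching_monomial r k) = monomial_value s (matching_exponent r k)"
        by (simp add: ev_def matching_monomial_def eval_monomial)
      also have "\<dots> = (\<Prod>i<r. s (if i < k then 2 * i else 2 * i + 1))"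
        by (simp add: matching_exponent_def monomial_value_sum monomial_value_single)
      also have "\<dots> = (\<Prod>i<r. if i < k \<longleftrightarrow> i < j then 1 else 0)"
        by (intro prod.cong) (auto simp: s_def)
      also have "\<dots> = (if k = j then 1 else 0)"
      proof (cases k j rule: linorder_cases)
        case less
        then show ?thesis using \<open>j \<le> r\<close> by (auto intro!: prod_zero bexI[of _ k])
      next
        case greater
        then show ?thesis using \<open>k \<le> r\<close> by (auto intro!: prod_zero bexI[of _ j])
      qed simp
      finally show ?thesis .
    qed
    let ?K = "{p \<in> carrier (poly_ring {..<2 * r}). ev p = 0}"
    assume eq: "genideal (poly_ring {..<2 * r}) (set (take j ?us @ drop (Suc j) ?us)) =
      Pf_ideal (2 * r + 1)"
    have "set (take j ?us @ drop (Suc j) ?us) \<subseteq> ?K"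
      using that by (auto simp: matching_monomials_def in_set_conv_nth ev matching_monomial_carrier
          simp del: upt_Suc)
    then have "Pf_ideal (2 * r + 1) \<subseteq> ?K"
      unfolding eq[symmetric] ev_def by (intro genideal_subset eval_kernel_ideal)
    moreover have "matching_monomial r j \<in> Pf_ideal (2 * r + 1)"
      unfolding Pf_ideal_eq using genideal_poly_ring(2)[OF set_matching_monomials_carrier] that
      by (auto simp: set_matching_monomials)
    ultimately show False using ev[OF that] by auto
  qed
  moreover have "length ?us = Suc r" by (simp add: matching_monomials_def)
  moreover have "homogeneous u" if "u \<in> set ?us" for u
    using that by (auto simp: set_matching_monomials homogeneous_def matching_monomial_def)
  ultimately show ?thesis
    unfolding minimal_homogeneous_generators_def
    using set_matching_monomials_carrier Pf_ideal_eq by (metis less_Suc_eq_le)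
qed

lemma Pf_ideal_monomial:
  "monomial_ideal {..<2 * r} (Pf_ideal (2 * r + 1) :: (nat, 'k::field) mpoly set)"
  unfolding monomial_ideal_def Pf_ideal_eq
  by (rule exI[of _ "matching_exponent r ` {..r}"])
    (auto simp: matching_exponent_monomials set_matching_monomials matching_monomial_def
      image_image)


section \<open>The presentation map on monomials\<close>

lemma prod_monom: "(\<Prod>v\<in>A. monom (a v) (d v)) = monom (\<Prod>v\<in>A. a v) (\<Sum>v\<in>A. d v)"
proof (induction A rule: infinite_finite_induct)
  case (insert x F)
  show ?case unfolding prod.insert[OF insert(1,2)] sum.insert[OF insert(1,2)] insert(3) mult_monom ..
next
  case empty
  show ?case by (simp only: prod.empty sum.empty monom_0 one_pCons)
next
  case (infinite A)
  show ?case unfolding prod.infinite[OF infinite] sum.infinite[OF infinite]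
    by (simp only: monom_0 one_pCons)
qed

lemma monomial_value_monom:
  assumes "\<And>v. v \<in> Poly_Mapping.keys m \<Longrightarrow> s v = monom (mpoly_monomial (e v)) (d v)"
  shows "monomial_value s m = monom
    (mpoly_monomial (\<Sum>v\<in>Poly_Mapping.keys m. \<Sum>_<Poly_Mapping.lookup m v. e v))
    (\<Sum>v\<in>Poly_Mapping.keys m. d v * Poly_Mapping.lookup m v)"
proof -
  have "monomial_value s m = (\<Prod>v\<in>Poly_Mapping.keys m.
      monom (\<Prod>_<Poly_Mapping.lookup m v. mpoly_monomial (e v)) (d v * Poly_Mapping.lookup m v))"
    unfolding monomial_value_def by (intro prod.cong) (simp_all add: assms monom_power)
  then show ?thesis by (simp only: prod_monom mpoly_monomial_sum)
qed

text \<open>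
  The presentation map sends a monomial \<open>m\<close> of \<open>A[y]\<close> to \<open>x\<^sup>e t\<^sup>d\<close> with \<open>e = rees_exponent r m\<close> and
  \<open>d = rees_degree r m\<close>. The inner sum in \<open>rees_exponent\<close> is the multiple of an exponent vector by a
  natural number.
\<close>

definition rees_degree :: "nat \<Rightarrow> (nat + nat) monomial \<Rightarrow> nat" where
  "rees_degree r m = (\<Sum>j\<le>r. Poly_Mapping.lookup m (Inr j))"

definition rees_exponent :: "nat \<Rightarrow> (nat + nat) monomial \<Rightarrow> nat monomial" where
  "rees_exponent r m = (\<Sum>v\<in>Poly_Mapping.keys m. \<Sum>_<Poly_Mapping.lookup m v.
     (case v of Inl i \<Rightarrow> Poly_Mapping.single i 1 | Inr j \<Rightarrow> matching_exponent r j))"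

abbreviation presentation_vars :: "nat \<Rightarrow> (nat + nat) set" where
  "presentation_vars r \<equiv> {..<2 * r} <+> {..r}"

lemma rees_vars_eq: "rees_vars (X3_vars (2 * r + 1)) (matching_monomials r) = presentation_vars r"
  by (simp add: rees_vars_def X3_vars_def matching_monomials_def lessThan_Suc_atMost)

abbreviation rees_value :: "nat \<Rightarrow> nat + nat \<Rightarrow> (nat, 'k::field) mpoly poly" where
  "rees_value r w \<equiv> (case w of Inl v \<Rightarrow> [:Var v:] | Inr j \<Rightarrow> monom (matching_monomials r ! j) 1)"

lemma nth_matching_monomials: "j \<le> r \<Longrightarrow> matching_monomials r ! j = matching_monomial r j"
  by (simp add: matching_monomials_def del: upt_Suc)

lemma sum_keys_Plus:
  assumes "m \<in> monomials (A <+> B)" "finite A" "finite B" and "\<And>v. f v 0 = 0"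
  shows "(\<Sum>v\<in>Poly_Mapping.keys m. f v (Poly_Mapping.lookup m v)) =
    (\<Sum>i\<in>A. f (Inl i) (Poly_Mapping.lookup m (Inl i))) +
    (\<Sum>j\<in>B. f (Inr j) (Poly_Mapping.lookup m (Inr j)))"
proof -
  have "(\<Sum>v\<in>Poly_Mapping.keys m. f v (Poly_Mapping.lookup m v)) =
      (\<Sum>v\<in>A <+> B. f v (Poly_Mapping.lookup m v))"
    using assms by (intro sum.mono_neutral_left) (auto simp: monomials_def in_keys_iff)
  then show ?thesis using assms by (simp add: sum.Plus)
qed

lemma rees_value_monomial:
  assumes "m \<in> monomials (presentation_vars r)"
  shows "monomial_value (rees_value r) m =
    monom (mpoly_monomial (rees_exponent r m) :: (nat, 'k::field) mpoly) (rees_degree r m)"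
proof -
  let ?e = "\<lambda>v. case v of Inl i \<Rightarrow> Poly_Mapping.single i 1 | Inr j \<Rightarrow> matching_exponent r j"
  let ?d = "\<lambda>v::nat + nat. case v of Inl i \<Rightarrow> 0 | Inr j \<Rightarrow> (1::nat)"
  have val: "(rees_value r v :: (nat, 'k) mpoly poly) = monom (mpoly_monomial (?e v)) (?d v)"
    if "v \<in> Poly_Mapping.keys m" for v
    using that assms
    by (auto simp: monomials_def Var_def monom_0 nth_matching_monomials matching_monomial_def
        split: sum.split)
  have "(\<Sum>v\<in>Poly_Mapping.keys m. ?d v * Poly_Mapping.lookup m v) = rees_degree r m"
    using sum_keys_Plus[OF assms, of "\<lambda>v n. ?d v * n"] by (simp add: rees_degree_def)
  with monomial_value_monom[of m "rees_value r :: _ \<Rightarrow> (nat, 'k) mpoly poly" ?e ?d, OF val]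
  show ?thesis by (simp only: rees_exponent_def)
qed

lemma lookup_rees_exponent:
  assumes "m \<in> monomials (presentation_vars r)" "v < 2 * r"
  shows "Poly_Mapping.lookup (rees_exponent r m) v = Poly_Mapping.lookup m (Inl v) +
    (\<Sum>j\<le>r. Poly_Mapping.lookup m (Inr j) * Poly_Mapping.lookup (matching_exponent r j) v)"
proof -
  let ?e = "\<lambda>v. case v of Inl i \<Rightarrow> Poly_Mapping.single i 1 | Inr j \<Rightarrow> matching_exponent r j"
  have "Poly_Mapping.lookup (rees_exponent r m) v =
      (\<Sum>w\<in>Poly_Mapping.keys m. Poly_Mapping.lookup m w * Poly_Mapping.lookup (?e w) v)"
    by (simp add: rees_exponent_def lookup_sum del: sum_constant) simp
  also have "\<dots> =
      (\<Sum>i<2 * r. Poly_Mapping.lookup m (Inl i) * Poly_Mapping.lookup (?e (Inl i)) v) +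
      (\<Sum>j\<le>r. Poly_Mapping.lookup m (Inr j) * Poly_Mapping.lookup (?e (Inr j)) v)"
    by (rule sum_keys_Plus[OF assms(1), of "\<lambda>w n. n * Poly_Mapping.lookup (?e w) v"]) simp_all
  also have "(\<Sum>i<2 * r. Poly_Mapping.lookup m (Inl i) * Poly_Mapping.lookup (?e (Inl i)) v) =
      (\<Sum>i<2 * r. if i = v then Poly_Mapping.lookup m (Inl i) else 0)"
    by (intro sum.cong) (auto simp: lookup_single when_def)
  finally show ?thesis using assms(2) by simp
qed

text \<open>
  The monomials that no \<open>x\<^bsub>2k\<^esub> y\<^sub>k\<close> with \<open>k < r\<close> divides.
\<close>

definition standard :: "nat \<Rightarrow> (nat + nat) monomial \<Rightarrow> bool" where
  "standard r m \<longleftrightarrow> (\<forall>k<r. Poly_Mapping.lookup m (Inl (2 * k)) = 0 \<or> Poly_Mapping.lookup m (Inr k) = 0)"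

text \<open>
  Suppose that \<open>n\<close> has more factors \<open>y\<^sub>i\<close> than \<open>m\<close>, and as many factors \<open>y\<^sub>j\<close> as \<open>m\<close> for each
  \<open>j < i\<close>. By equality of degrees \<open>n\<close> has fewer factors \<open>y\<^sub>j\<close> with \<open>j > i\<close> than \<open>m\<close>. Each of these
  contributes one \<open>x\<^bsub>2i\<^esub>\<close> to the image, and the \<open>y\<^sub>j\<close> with \<open>j \<le> i\<close> contribute none; so \<open>n\<close> itself has
  to contain \<open>x\<^bsub>2i\<^esub>\<close>. But it contains \<open>y\<^sub>i\<close> and is standard. The case \<open>i = r\<close> is excluded by the
  degrees alone.
\<close>

lemma standard_y_exponent_le:
  assumes m: "m \<in> monomials (presentation_vars r)" and n: "n \<in> monomials (presentation_vars r)"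
    and std: "standard r n"
    and deg: "rees_degree r m = rees_degree r n" and ex: "rees_exponent r m = rees_exponent r n"
    and less: "\<And>j. j < i \<Longrightarrow> Poly_Mapping.lookup m (Inr j) = Poly_Mapping.lookup n (Inr j)"
    and i: "i \<le> r"
  shows "Poly_Mapping.lookup n (Inr i) \<le> Poly_Mapping.lookup m (Inr i)"
proof (rule ccontr)
  assume "\<not> ?thesis"
  then have lt: "Poly_Mapping.lookup m (Inr i) < Poly_Mapping.lookup n (Inr i)" by simp
  let ?t = "\<lambda>m. \<Sum>j\<in>{i<..r}. Poly_Mapping.lookup m (Inr j)"
  have split: "{..r} = {..<i} \<union> ({i} \<union> {i<..r})" using i by auto
  have deg_split: "rees_degree r m = (\<Sum>j<i. Poly_Mapping.lookup m (Inr j)) +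
      (Poly_Mapping.lookup m (Inr i) + ?t m)" for m
    unfolding rees_degree_def split by (subst sum.union_disjoint; force)+
  have "(\<Sum>j<i. Poly_Mapping.lookup m (Inr j)) = (\<Sum>j<i. Poly_Mapping.lookup n (Inr j))"
    using less by simp
  then have tail: "?t n < ?t m" using deg deg_split[of m] deg_split[of n] lt by linarith
  show False
  proof (cases "i < r")
    case True
    have exp: "Poly_Mapping.lookup (rees_exponent r m) (2 * i) =
        Poly_Mapping.lookup m (Inl (2 * i)) + ?t m"
      if "m \<in> monomials (presentation_vars r)" for m
    proof -
      have "(\<Sum>j\<le>r. Poly_Mapping.lookup m (Inr j) *
          Poly_Mapping.lookup (matching_exponent r j) (2 * i)) = ?t m"
        using True by (intro sum.mono_neutral_cong_right) (auto simp: lookup_matching_exponent_even)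
      then show ?thesis using lookup_rees_exponent[OF that, of "2 * i"] True by simp
    qed
    have "Poly_Mapping.lookup n (Inl (2 * i)) = 0" using std lt True by (auto simp: standard_def)
    then show False using exp[OF m] exp[OF n] ex tail by simp
  next
    case False
    then show False using tail i by simp
  qed
qed

text \<open>
  The exponents of the \<open>y\<close>'s agree by induction on the index, from the preceding lemma in both
  directions. The image minus the contribution of the \<open>y\<close>'s then gives the exponents of the \<open>x\<close>'s.
\<close>

lemma standard_inj:
  assumes m: "m \<in> monomials (presentation_vars r)" "standard r m"
    and n: "n \<in> monomials (presentation_vars r)" "standard r n"
    and deg: "rees_degree r m = rees_degree r n" and ex: "rees_exponent r m = rees_exponent r n"
  shows "m = n"
proof (rule poly_mapping_eqI)
  have y: "Poly_Mapping.lookup m (Inr i) = Poly_Mapping.lookup n (Inr i)" if "i \<le> r" for i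
    using that
  proof (induction i rule: less_induct)
    case (less i)
    then have IH: "Poly_Mapping.lookup m (Inr j) = Poly_Mapping.lookup n (Inr j)" if "j < i" for j
      using that by simp
    show ?case
      by (rule order.antisym[OF
            standard_y_exponent_le[OF n(1) m deg[symmetric] ex[symmetric] IH[symmetric] less.prems]
            standard_y_exponent_le[OF m(1) n deg ex IH less.prems]])
  qed
  have x: "Poly_Mapping.lookup m (Inl v) = Poly_Mapping.lookup n (Inl v)" if "v < 2 * r" for v
    using lookup_rees_exponent[OF m(1) that] lookup_rees_exponent[OF n(1) that] y ex by simp
  fix v
  show "Poly_Mapping.lookup m v = Poly_Mapping.lookup n v"
  proof (cases "v \<in> presentation_vars r")
    case False
    then have "v \<notin> Poly_Mapping.keys m" "v \<notin> Poly_Mapping.keys n"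
      using m n by (auto simp: monomials_def)
    then show ?thesis by (simp add: in_keys_iff)
  qed (auto simp: x y)
qed

lemma rees_ideal_eq: "rees_ideal (X3_vars (2 * r + 1)) I (matching_monomials r) =
  {f \<in> carrier (poly_ring (presentation_vars r)). rees_map (matching_monomials r) f = 0}"
  unfolding rees_ideal_def a_kernel_def' rees_vars_eq by (simp add: rees_algebra_def)

lemma rees_map_ideal: "ideal {f \<in> carrier (poly_ring V). rees_map us f = 0} (poly_ring V)"
  unfolding rees_map_def by (rule coefficient_hom.eval_kernel_ideal[OF coefficient_hom_Const])

text \<open>
  Distinct standard monomials have distinct images \<open>x\<^sup>e t\<^sup>d\<close>, which are linearly independent: the
  coefficient of \<open>f\<close> at \<open>m\<close> is the coefficient of its image at the image of \<open>m\<close>.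
\<close>

lemma rees_map_standard_eq_0:
  fixes f :: "(nat + nat, 'k::field) mpoly"
  assumes f: "f \<in> carrier (poly_ring (presentation_vars r))" "rees_map (matching_monomials r) f = 0"
    and std: "\<And>m. m \<in> Poly_Mapping.keys f \<Longrightarrow> standard r m"
  shows "f = 0"
proof (rule ccontr)
  interpret coefficient_hom "\<lambda>c::'k. [:Const c :: (nat, 'k) mpoly:]" by (rule coefficient_hom_Const)
  assume "f \<noteq> 0"
  then obtain m where m: "m \<in> Poly_Mapping.keys f" by (metis keys_eq_empty ex_in_conv)
  have mon: "n \<in> monomials (presentation_vars r)" if "n \<in> Poly_Mapping.keys f" for n
    using that f(1) by (auto simp: poly_ring_simps)
  have "rees_map (matching_monomials r) f = (\<Sum>n\<in>Poly_Mapping.keys f.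
      [:Const (Poly_Mapping.lookup f n):] * monomial_value (rees_value r) n)"
    unfolding rees_map_def by (rule eval_superset) auto
  also have "\<dots> = (\<Sum>n\<in>Poly_Mapping.keys f.
      monom (Poly_Mapping.single (rees_exponent r n) (Poly_Mapping.lookup f n)) (rees_degree r n))"
    by (intro sum.cong refl)
      (simp add: rees_value_monomial mon Const_def mpoly_monomial_def smult_monom mult_single)
  finally have eq: "rees_map (matching_monomials r) f = (\<Sum>n\<in>Poly_Mapping.keys f.
      monom (Poly_Mapping.single (rees_exponent r n) (Poly_Mapping.lookup f n)) (rees_degree r n))" .
  have "Poly_Mapping.lookup (coeff (rees_map (matching_monomials r) f) (rees_degree r m))
        (rees_exponent r m) =
      (\<Sum>n\<in>Poly_Mapping.keys f. if n = m then Poly_Mapping.lookup f m else 0)"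
    unfolding eq coeff_sum lookup_sum
  proof (intro sum.cong refl)
    fix n assume n: "n \<in> Poly_Mapping.keys f"
    have "n = m" if "rees_degree r n = rees_degree r m" "rees_exponent r n = rees_exponent r m"
      using standard_inj[OF mon[OF n] std[OF n] mon[OF m] std[OF m] that] .
    then show "Poly_Mapping.lookup (coeff (monom (Poly_Mapping.single (rees_exponent r n)
        (Poly_Mapping.lookup f n)) (rees_degree r n)) (rees_degree r m)) (rees_exponent r m) =
        (if n = m then Poly_Mapping.lookup f m else 0)"
      by (auto simp: lookup_single when_def)
  qed
  then show False using f(2) m by (simp add: in_keys_iff)
qed

section \<open>The exchange relations\<close>

text \<open>
  The \<open>k\<close>-th exchange relation is \<open>x\<^bsub>2k\<^esub> y\<^sub>k - x\<^bsub>2k+1\<^esub> y\<^bsub>k+1\<^esub>\<close>.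
\<close>

definition lead_exponent :: "nat \<Rightarrow> (nat + nat) monomial" where
  "lead_exponent k = Poly_Mapping.single (Inl (2 * k)) 1 + Poly_Mapping.single (Inr k) 1"

definition trail_exponent :: "nat \<Rightarrow> (nat + nat) monomial" where
  "trail_exponent k = Poly_Mapping.single (Inl (2 * k + 1)) 1 + Poly_Mapping.single (Inr (k + 1)) 1"

definition exchange_relation :: "nat \<Rightarrow> (nat + nat, 'k::field) mpoly" where
  "exchange_relation k = mpoly_monomial (lead_exponent k) - mpoly_monomial (trail_exponent k)"

lemma exchange_exponents_monomials:
  assumes "k < r"
  shows "lead_exponent k \<in> monomials (presentation_vars r)"
    and "trail_exponent k \<in> monomials (presentation_vars r)"
  using assms unfolding lead_exponent_def trail_exponent_def
  by (intro monomials_add; force simp: monomials_def)+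

lemma rees_map_exchange:
  assumes "k < r"
  shows "rees_map (matching_monomials r) (exchange_relation k :: (nat + nat, 'k::field) mpoly) = 0"
proof -
  interpret coefficient_hom "\<lambda>c::'k. [:Const c :: (nat, 'k) mpoly:]" by (rule coefficient_hom_Const)
  have "mpoly_monomial (Poly_Mapping.single (2 * k) 1 + matching_exponent r k) =
      (mpoly_monomial (Poly_Mapping.single (2 * k + 1) 1 + matching_exponent r (Suc k)) :: (nat, 'k) mpoly)"
    by (simp only: matching_exponent_exchange[OF assms])
  then have "Var (2 * k) * matching_monomial r k =
      (Var (2 * k + 1) * matching_monomial r (Suc k) :: (nat, 'k) mpoly)"
    by (simp only: mpoly_monomial_add Var_def matching_monomial_def)
  then show ?thesis using assms
    by (simp add: rees_map_def exchange_relation_def eval_diff eval_monomial lead_exponent_def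
        trail_exponent_def monomial_value_add nth_matching_monomials smult_monom)
qed

lemma keys_exchange:
  "Poly_Mapping.keys (exchange_relation k :: (nat + nat, 'k::field) mpoly) =
    {lead_exponent k, trail_exponent k}"
proof -
  have "Poly_Mapping.lookup (lead_exponent k) (Inr k) \<noteq> Poly_Mapping.lookup (trail_exponent k) (Inr k)"
    by (simp add: lead_exponent_def trail_exponent_def lookup_add lookup_single)
  then have "lead_exponent k \<noteq> trail_exponent k" by auto
  then show ?thesis
    by (auto simp: exchange_relation_def mpoly_monomial_def in_keys_iff lookup_minus
        lookup_single when_def split: if_splits)
qed

lemma exchange_carrier:
  "k < r \<Longrightarrow> exchange_relation k \<in> carrier (poly_ring (presentation_vars r))"
  by (simp add: poly_ring_simps keys_exchange exchange_exponents_monomials)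

lemma linear_exchange: "linear_in_y (exchange_relation k :: (nat + nat, 'k::field) mpoly)"
proof -
  have "(\<Sum>w\<in>Poly_Mapping.keys m \<inter> range Inr. Poly_Mapping.lookup m w) = 1"
    if m: "m = Poly_Mapping.single (Inl i) 1 + Poly_Mapping.single (Inr j) 1"
    for m :: "(nat + nat) monomial" and i j
  proof -
    have "Poly_Mapping.keys m \<inter> range Inr = {Inr j}"
      by (auto simp: m in_keys_iff lookup_add lookup_single when_def split: if_splits)
    then show ?thesis by (simp add: m lookup_add lookup_single)
  qed
  then show ?thesis
    by (simp add: linear_in_y_def keys_exchange lead_exponent_def trail_exponent_def)
qed

text \<open>
  The bijection \<open>sum_encode\<close> gives \<open>x\<^sub>i\<close> the number \<open>2i\<close> and \<open>y\<^sub>j\<close> the number \<open>2j + 1\<close>. So \<open>y\<^sub>k\<close> is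
  larger than both \<open>x\<^bsub>2k+1\<^esub>\<close> and \<open>y\<^bsub>k+1\<^esub>\<close>, which makes \<open>x\<^bsub>2k\<^esub> y\<^sub>k\<close> the leading monomial of the
  exchange relation.
\<close>

abbreviation rees_order :: "nat \<Rightarrow> (nat + nat) monomial rel" where
  "rees_order r \<equiv> lex_order sum_encode (presentation_vars r)"

lemma rees_order: "monomial_order (presentation_vars r) (rees_order r)"
  by (rule monomial_order_lex) (rule bij_sum_encode)

lemma trail_less_lead:
  assumes "k < r"
  shows "(trail_exponent k, lead_exponent k) \<in> rees_order r"
proof -
  let ?M = "Poly_Mapping.map_key (inv_into UNIV sum_encode)"
  have inv: "inv_into UNIV sum_encode = sum_decode"
    by (rule inv_equality) (simp_all add: sum_encode_inverse sum_decode_inverse)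
  have "?M (trail_exponent k) < ?M (lead_exponent k)"
    unfolding less_poly_mapping_iff inv
    \<comment> \<open>the number of the most significant indeterminate: \<open>x\<^sub>0\<close> if \<open>k = 0\<close>, and otherwise \<open>y\<^sub>k\<close>\<close>
  proof (intro exI[of _ "if k = 0 then 0 else 2 * k + 1"] conjI allI impI)
    let ?p = "if k = 0 then 0 else 2 * k + 1"
    have look: "Poly_Mapping.lookup (Poly_Mapping.map_key sum_decode
          (Poly_Mapping.single v 1 + Poly_Mapping.single w 1)) i =
       (if i = sum_encode v then 1 else 0) + (if i = sum_encode w then 1 else (0::nat))" for v w i
      using inj_sum_decode[of UNIV]
      by (auto simp: lookup_map_key lookup_add lookup_single when_def sum_encode_inverse
          sum_decode_inverse)
    show "Poly_Mapping.lookup (Poly_Mapping.map_key sum_decode (trail_exponent k)) ?p <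
        Poly_Mapping.lookup (Poly_Mapping.map_key sum_decode (lead_exponent k)) ?p"
      unfolding trail_exponent_def lead_exponent_def look
      by (cases "k = 0") (auto simp: sum_encode_def)
    show "Poly_Mapping.lookup (Poly_Mapping.map_key sum_decode (trail_exponent k)) i =
        Poly_Mapping.lookup (Poly_Mapping.map_key sum_decode (lead_exponent k)) i"
      if "i < ?p" for i
      using that unfolding trail_exponent_def lead_exponent_def look
      by (cases "k = 0") (auto simp: sum_encode_def)
  qed
  then show ?thesis
    using exchange_exponents_monomials[OF assms] by (simp add: lex_order_def)
qed

lemma lead_monomial_exchange:
  assumes "k < r"
  shows "lead_monomial (rees_order r) (exchange_relation k :: (nat + nat, 'k::field) mpoly) =
    lead_exponent k"
  using assms trail_less_lead monomial_order_refl[OF rees_order] exchange_exponents_monomials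
  by (intro lead_monomial_eqI[OF rees_order]) (auto simp: keys_exchange)

lemma nonstandard_divisible:
  assumes "m \<in> monomials (presentation_vars r)" "\<not> standard r m"
  obtains k c where "k < r" "c \<in> monomials (presentation_vars r)" "m = c + lead_exponent k"
proof -
  from assms(2) obtain k where k: "k < r" "Poly_Mapping.lookup m (Inl (2 * k)) \<noteq> 0"
      "Poly_Mapping.lookup m (Inr k) \<noteq> 0"
    by (auto simp: standard_def)
  have "m = (m - lead_exponent k) + lead_exponent k"
    using k by (intro poly_mapping_eqI)
      (auto simp: lead_exponent_def lookup_add lookup_minus lookup_single when_def)
  moreover have "m - lead_exponent k \<in> monomials (presentation_vars r)"
    using assms(1) by (auto simp: monomials_def in_keys_iff lookup_minus)
  ultimately show ?thesis using that k(1) by blast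
qed

text \<open>
  Each application of an exchange relation replaces a factor \<open>y\<^sub>k\<close> by \<open>y\<^bsub>k+1\<^esub>\<close>. Giving \<open>y\<^sub>j\<close> the weight
  \<open>r - j\<close> and all \<open>x\<^sub>i\<close> the weight \<open>0\<close> turns this into a strict decrease of a natural number.
\<close>

lemma reduce_to_standard:
  assumes "m \<in> monomials (presentation_vars r)"
  shows "\<exists>n\<in>monomials (presentation_vars r). standard r n \<and> (n, m) \<in> rees_order r \<and>
    (mpoly_monomial m - mpoly_monomial n :: (nat + nat, 'k::field) mpoly)
      \<in> genideal (poly_ring (presentation_vars r)) (exchange_relation ` {..<r})"
    (is "\<exists>n\<in>?M. standard r n \<and> (n, m) \<in> ?ord \<and> ?d m n \<in> ?I")
  using assms
proof (induction "\<Sum>j\<le>r. (r - j) * Poly_Mapping.lookup m (Inr j)" arbitrary: m rule: less_induct)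
  case less
  have carr: "(exchange_relation ` {..<r} :: (nat + nat, 'k) mpoly set)
      \<subseteq> carrier (poly_ring (presentation_vars r))"
    by (auto simp: exchange_carrier)
  note I = genideal_poly_ring[OF carr]
  show ?case
  proof (cases "standard r m")
    case True
    then show ?thesis using less.prems monomial_order_refl[OF rees_order] ideal_zero[OF I(1)]
      by (intro bexI[of _ m]) auto
  next
    case False
    from nonstandard_divisible[OF less.prems False] obtain k c where
      k: "k < r" and c: "c \<in> ?M" and m: "m = c + lead_exponent k" by blast
    let ?n = "c + trail_exponent k"
    have n: "?n \<in> ?M" using c exchange_exponents_monomials[OF k] by (simp add: monomials_add)
    let ?w = "\<lambda>m :: (nat + nat) monomial. \<Sum>j\<le>r. (r - j) * Poly_Mapping.lookup m (Inr j)"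
    have "?w (lead_exponent k) = r - k" "?w (trail_exponent k) = r - Suc k"
      using k by (simp_all add: lead_exponent_def trail_exponent_def lookup_add lookup_single when_def
        if_distrib cong: if_cong)
    moreover have "?w (a + b) = ?w a + ?w b" for a b
      by (simp add: lookup_add distrib_left sum.distrib)
    ultimately have "?w ?n < ?w m" using k by (simp add: m)
    from less.hyps[OF this n] obtain l where
      l: "l \<in> ?M" "standard r l" "(l, ?n) \<in> ?ord" "?d ?n l \<in> ?I"
      by blast
    have "(?n, m) \<in> ?ord"
      using monomial_order_add[OF rees_order trail_less_lead[OF k] c] by (simp add: m add.commute)
    then have ord: "(l, m) \<in> ?ord" using monomial_order_trans[OF rees_order l(3)] by blast
    have "mpoly_monomial c * exchange_relation k \<in> ?I"
      using k c I(2) by (intro ideal_mult[OF I(1)]) auto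
    then have "mpoly_monomial c * exchange_relation k + ?d ?n l \<in> ?I"
      using ideal_add[OF I(1)] l(4) by blast
    also have "mpoly_monomial c * exchange_relation k + ?d ?n l = ?d m l"
      by (simp add: m exchange_relation_def mpoly_monomial_add algebra_simps)
    finally show ?thesis using l ord by blast
  qed
qed

theorem theorem3p2:
  fixes r n :: nat and I :: "(nat, 'k::field_char_0) mpoly set"
  assumes "n = 2 * r + 1"
    and "I = Pf_ideal n"
  shows "monomial_ideal (X3_vars n) I \<and>
    groebner_linear_type (X3_vars n) I (filter (\<lambda>p. p \<noteq> 0) (X3_pfaffians n))"
proof -
  have V: "X3_vars n = {..<2 * r}" by (simp add: assms X3_vars_def)
  have us: "filter (\<lambda>p. p \<noteq> 0) (X3_pfaffians n) = (matching_monomials r :: (nat, 'k) mpoly list)"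
    unfolding assms by (rule nonzero_X3_pfaffians)
  let ?W = "presentation_vars r"
  let ?us = "matching_monomials r :: (nat, 'k) mpoly list"
  let ?G = "exchange_relation ` {..<r} :: (nat + nat, 'k) mpoly set"
  define J where "J = rees_ideal (X3_vars n) I ?us"
  have J_eq: "J = {f \<in> carrier (poly_ring ?W). rees_map ?us f = 0}"
    unfolding J_def assms(1) by (rule rees_ideal_eq)
  have J: "ideal J (poly_ring ?W)" unfolding J_eq by (rule rees_map_ideal)
  have GJ: "?G \<subseteq> J" by (auto simp: J_eq exchange_carrier rees_map_exchange)
  have nonstandard: "\<exists>g\<in>?G. g \<noteq> 0 \<and> (\<exists>c\<in>monomials ?W. m = c + lead_monomial (rees_order r) g)"
    if "m \<in> monomials ?W" "\<not> standard r m" for m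
  proof -
    from that obtain k c where k: "k < r" "c \<in> monomials ?W" "m = c + lead_exponent k"
      by (rule nonstandard_divisible)
    moreover have "(exchange_relation k :: (nat + nat, 'k) mpoly) \<noteq> 0"
      using keys_exchange[of k, where 'k = 'k] by auto
    ultimately show ?thesis
      by (intro bexI[of _ "exchange_relation k"]) (auto simp: lead_monomial_exchange)
  qed
  have independent: "f = 0"
    if "f \<in> J" "\<And>m. m \<in> Poly_Mapping.keys f \<Longrightarrow> standard r m" for f
    using that unfolding J_eq by (intro rees_map_standard_eq_0) auto
  note basis = groebner_basis_by_standard_monomials[OF rees_order J finite_imageI[OF finite_lessThan]
      GJ reduce_to_standard nonstandard independent]
  have J_gen: "J = genideal (poly_ring ?W) ?G" by (rule basis)
  have gb: "groebner_basis ?W (rees_order r) ?G J" by (rule basis)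
  have W: "rees_vars (X3_vars n) ?us = ?W" unfolding assms by (rule rees_vars_eq)
  have lin: "?G \<subseteq> linear_relations (X3_vars n) I ?us"
    using GJ linear_exchange by (auto simp: linear_relations_def J_def)
  have "J = genideal (poly_ring ?W) (linear_relations (X3_vars n) I ?us)"
  proof
    have LJ: "linear_relations (X3_vars n) I ?us \<subseteq> J" by (auto simp: linear_relations_def J_def)
    then have "linear_relations (X3_vars n) I ?us \<subseteq> carrier (poly_ring ?W)"
      using ideal_subset_carrier[OF J] by blast
    from genideal_poly_ring[OF this] lin
    show "J \<subseteq> genideal (poly_ring ?W) (linear_relations (X3_vars n) I ?us)"
      unfolding J_gen by (intro genideal_subset) auto
    show "genideal (poly_ring ?W) (linear_relations (X3_vars n) I ?us) \<subseteq> J"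
      by (rule genideal_subset[OF J LJ])
  qed
  moreover have "minimal_homogeneous_generators (X3_vars n) I ?us"
    unfolding V assms(2) unfolding assms(1) by (rule minimal_generators)
  ultimately have "linear_type (X3_vars n) I ?us"
    unfolding linear_type_def W J_def[symmetric] by blast
  moreover have "monomial_ideal (X3_vars n) I"
    unfolding V assms(2) unfolding assms(1) by (rule Pf_ideal_monomial)
  ultimately show ?thesis
    unfolding us groebner_linear_type_def W J_def[symmetric] using rees_order lin gb by blast
qed

end
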